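(* Let $m\ge1$ and let $\Omega=\{(\lambda,u)\in\mathbb R\oplus\mathbb R^m:\lambda>\|u\|\}$ be the Lorentz cone. For $x=(\lambda,u)$ and $y=(\mu,v)$ in $\Omega$ put $\Delta_x=\lambda^2-\|u\|^2$, $\Delta_y=\mu^2-\|v\|^2$, and $\beta(x,y)=\lambda\mu-\langle u,v\rangle$. Then the metric geometric mean of $x$ and $y$ is $$x\mathbin{\#}y=\frac{\sqrt{\Delta_y}\,x+\sqrt{\Delta_x}\,y}{\sqrt{2\bigl(\beta(x,y)+\sqrt{\Delta_x\Delta_y}\bigr)}},$$ that is, $$x\mathbin{\#}y=\left(\frac{\sqrt{\Delta_y}\,\lambda+\sqrt{\Delta_x}\,\mu}{\sqrt{2\bigl(\lambda\mu-\langle u,v\rangle+\sqrt{\Delta_x\Delta_y}\bigr)}},\ \frac{\sqrt{\Delta_y}\,u+\sqrt{\Delta_x}\,v}{\sqrt{2\bigl(\lambda\mu-\langle u,v\rangle+\sqrt{\Delta_x\Delta_y}\bigr)}}\right).$$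
   Context: $V=\mathbb R\oplus\mathbb R^m$ is the Euclidean Jordan algebra (spin factor) with product $(\lambda,u)\circ(\mu,v)=(\lambda\mu+\langle u,v\rangle,\ \lambda v+\mu u)$ and unit $e=(1,0)$, where $\langle\cdot,\cdot\rangle$ is the standard inner product of $\mathbb R^m$; its symmetric cone is the Lorentz cone $\Omega$. With $L(x)y=x\circ y$, the quadratic representation is $P(x)=2L(x)^2-L(x\circ x)$. For $x=(\lambda,u)\in\Omega$, the inverse is $x^{-1}=\frac{1}{\lambda^2-\|u\|^2}(\lambda,-u)$, $x^{1/2}$ is the unique element of $\Omega$ with $x^{1/2}\circ x^{1/2}=x$, and $x^{-1/2}=(x^{1/2})^{-1}$. The metric geometric mean of $a,b\in\Omega$ is $a\mathbin{\#}b=P(a^{1/2})\bigl(P(a^{-1/2})b\bigr)^{1/2}$. *)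

theory Defs
  imports "HOL-Analysis.Analysis"
begin

text \<open>
  The spin factor is carried by the product type \<^typ>\<open>real \<times> (real ^ 'm)\<close>, with the vector space
  structure of the library. Types are nonempty, so \<open>CARD('m) \<ge> 1\<close> holds automatically.
\<close>

type_synonym 'm spin = "real \<times> (real ^ 'm)"

definition jordan_prod :: "'m::finite spin \<Rightarrow> 'm spin \<Rightarrow> 'm spin" (infixl "\<circ>\<^sub>J" 70) where
  "x \<circ>\<^sub>J y =
     (fst x * fst y + inner (snd x) (snd y), fst x *\<^sub>R snd y + fst y *\<^sub>R snd x)"

definition lorentz_cone :: "'m::finite spin set" where
  "lorentz_cone = {(l, u). l > norm u}"

definition jordan_L :: "'m::finite spin \<Rightarrow> 'm spin \<Rightarrow> 'm spin" where
  "jordan_L x = (\<lambda>y. x \<circ>\<^sub>J y)"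

definition jordan_P :: "'m::finite spin \<Rightarrow> 'm spin \<Rightarrow> 'm spin" where
  "jordan_P x = (\<lambda>y. 2 *\<^sub>R jordan_L x (jordan_L x y) - jordan_L (x \<circ>\<^sub>J x) y)"

definition spin_Delta :: "'m::finite spin \<Rightarrow> real" where
  "spin_Delta x = (fst x)\<^sup>2 - (norm (snd x))\<^sup>2"

definition spin_beta :: "'m::finite spin \<Rightarrow> 'm spin \<Rightarrow> real" where
  "spin_beta x y = fst x * fst y - inner (snd x) (snd y)"

definition jordan_inv :: "'m::finite spin \<Rightarrow> 'm spin" where
  "jordan_inv x = (1 / spin_Delta x) *\<^sub>R (fst x, - snd x)"

definition jordan_sqrt :: "'m::finite spin \<Rightarrow> 'm spin" where
  "jordan_sqrt x = (THE z. z \<in> lorentz_cone \<and> z \<circ>\<^sub>J z = x)"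

definition geometric_mean :: "'m::finite spin \<Rightarrow> 'm spin \<Rightarrow> 'm spin" (infixl "#\<^sub>J" 70) where
  "a #\<^sub>J b =
     jordan_P (jordan_sqrt a) (jordan_sqrt (jordan_P (jordan_inv (jordan_sqrt a)) b))"

text \<open>The description in \<^const>\<open>jordan_sqrt\<close> is proper on the cone.\<close>

lemma jordan_sqrt_ex1:
  fixes x :: "'m::finite spin"
  assumes "x \<in> lorentz_cone"
  shows "\<exists>!z. z \<in> lorentz_cone \<and> z \<circ>\<^sub>J z = x"
proof -
  obtain l u where x: "x = (l, u)" by (cases x)
  have lu: "norm u < l" using assms by (simp add: x lorentz_cone_def)
  define d where "d = sqrt (l\<^sup>2 - (norm u)\<^sup>2)"
  have l0: "0 < l" using lu norm_ge_zero[of u] by linarith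
  have lu2: "(norm u)\<^sup>2 < l\<^sup>2" using lu by (simp add: power_strict_mono)
  have d0: "0 < d" and d2: "d\<^sup>2 = l\<^sup>2 - (norm u)\<^sup>2" using lu2 by (simp_all add: d_def)
  define s where "s = sqrt ((l + d) / 2)"
  have s0: "0 < s" and s2: "s\<^sup>2 = (l + d) / 2" using l0 d0 by (simp_all add: s_def)
  have nu: "(norm u)\<^sup>2 = (l + d) * (l - d)" using d2 by (simp add: algebra_simps power2_eq_square)
  define w where "w = (1 / (2 * s)) *\<^sub>R u"
  have "(norm w)\<^sup>2 = (norm u)\<^sup>2 / (4 * s\<^sup>2)"
    using s0 by (simp add: w_def power_mult_distrib power_divide field_simps)
  also have "\<dots> = (l - d) / 2" using l0 d0 by (simp add: nu s2 field_simps)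
  finally have w2: "(norm w)\<^sup>2 = (l - d) / 2" .
  have "(norm w)\<^sup>2 < s\<^sup>2" using d0 by (simp add: w2 s2)
  then have "norm w < s" using s0 by (simp add: power2_less_imp_less)
  moreover have "(s, w) \<circ>\<^sub>J (s, w) = x"
  proof -
    have "s * s + inner w w = l"
      using s2 w2 by (simp add: dot_square_norm flip: power2_eq_square)
    moreover have "s *\<^sub>R w + s *\<^sub>R w = u"
      using s0 by (simp add: w_def flip: scaleR_add_left)
    ultimately show ?thesis by (simp add: jordan_prod_def x)
  qed
  ultimately have ex: "(s, w) \<in> lorentz_cone \<and> (s, w) \<circ>\<^sub>J (s, w) = x"
    by (simp add: lorentz_cone_def)
  show ?thesis
  proof (rule ex1I[of _ "(s, w)"], rule ex)
    fix z :: "'m spin" assume z: "z \<in> lorentz_cone \<and> z \<circ>\<^sub>J z = x"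
    obtain t v where zt: "z = (t, v)" by (cases z)
    have tv: "norm v < t" using z by (simp add: zt lorentz_cone_def)
    have t0: "0 < t" using tv norm_ge_zero[of v] by linarith
    have l: "l = t\<^sup>2 + (norm v)\<^sup>2" and "u = t *\<^sub>R v + t *\<^sub>R v"
      using z by (auto simp: zt x jordan_prod_def dot_square_norm simp flip: power2_eq_square)
    then have u: "u = (2 * t) *\<^sub>R v"
      by (simp only: mult_2 scaleR_add_left)
    have "l\<^sup>2 - (norm u)\<^sup>2 = (t\<^sup>2 - (norm v)\<^sup>2)\<^sup>2"
      by (simp add: l u power_mult_distrib) (simp add: power2_eq_square algebra_simps)
    moreover have "(norm v)\<^sup>2 < t\<^sup>2" using tv by (simp add: power_strict_mono)
    ultimately have "d = t\<^sup>2 - (norm v)\<^sup>2" by (simp add: d_def)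
    then have "s\<^sup>2 = t\<^sup>2" by (simp add: s2 l)
    then have "t = s" using s0 t0 by (simp add: power2_eq_iff)
    then show "z = (s, w)" using s0 by (simp add: zt w_def u)
  qed
qed

end

theory Submission
  imports Defs
begin

text \<open>
  Put \<open>a = x\<^sup>1\<^sup>/\<^sup>2\<close> and \<open>z = P(a\<^sup>-\<^sup>1) y\<close>, so that the mean is \<open>P(a) z\<^sup>1\<^sup>/\<^sup>2\<close>. The spin
  factor has rank two, hence the Cayley--Hamilton identity \<open>w\<^sup>2 - 2 (fst w) w + \<Delta>(w) e = 0\<close> makes
  every square root an explicit linear combination
  \<open>z\<^sup>1\<^sup>/\<^sup>2 = (z + \<surd>\<Delta>(z) e) / \<surd>(2 (fst z + \<surd>\<Delta>(z)))\<close>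
  (\<open>jordan_sqrt_eq\<close>). The map \<open>P(a)\<close> is linear, sends \<open>e\<close> to \<open>a\<^sup>2 = x\<close> and \<open>z\<close> back to \<open>y\<close>
  (\<open>jordan_P_inverse\<close>), so
  \<open>P(a) z\<^sup>1\<^sup>/\<^sup>2 = (y + \<surd>\<Delta>(z) x) / \<surd>(2 (fst z + \<surd>\<Delta>(z)))\<close>.
  It remains to express the two invariants of \<open>z\<close> by \<open>x\<close> and \<open>y\<close>. The determinant is multiplicative,
  \<open>\<Delta>(P(a) y) = \<Delta>(a)\<^sup>2 \<Delta>(y)\<close> (\<open>spin_Delta_jordan_P\<close>), which gives \<open>\<Delta>(z) = \<Delta>(y) / \<Delta>(x)\<close>;
  and \<open>P(a\<^sup>-\<^sup>1)\<close> is self-adjoint, so that \<open>fst z = \<langle>e, P(a\<^sup>-\<^sup>1) y\<rangle> = \<langle>x\<^sup>-\<^sup>1, y\<rangle> = \<beta>(x, y) / \<Delta>(x)\<close>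
  (\<open>fst_jordan_P_inv\<close>). Multiplying numerator and denominator by \<open>\<surd>\<Delta>(x)\<close> yields the
  symmetric formula.
\<close>

lemma spin_Delta_eq: "spin_Delta a = fst a * fst a - inner (snd a) (snd a)"
  by (simp add: spin_Delta_def power2_norm_eq_inner) (simp add: power2_eq_square)

lemma lorentz_cone_iff: "z \<in> lorentz_cone \<longleftrightarrow> 0 < fst z \<and> 0 < spin_Delta z"
proof -
  have "norm (snd z) < fst z \<longleftrightarrow> 0 < fst z \<and> (norm (snd z))\<^sup>2 < (fst z)\<^sup>2"
    by (auto intro: power2_less_imp_less power_strict_mono le_less_trans[OF norm_ge_zero])
  then show ?thesis by (simp add: lorentz_cone_def spin_Delta_def case_prod_beta)
qed

text \<open>By the Cauchy--Schwarz inequality; the positivity puts \<open>P(a\<^sup>-\<^sup>1) y\<close> into the cone, where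
  its square root is described by \<open>jordan_sqrt_eq\<close>.\<close>

lemma spin_beta_pos:
  assumes "x \<in> lorentz_cone" and "y \<in> lorentz_cone"
  shows "0 < spin_beta x y"
proof -
  have x: "norm (snd x) < fst x" and y: "norm (snd y) < fst y"
    using assms by (auto simp: lorentz_cone_def)
  have "inner (snd x) (snd y) \<le> norm (snd x) * norm (snd y)"
    by (rule norm_cauchy_schwarz)
  also have "\<dots> < fst x * fst y"
    using x y by (intro mult_strict_mono') auto
  finally show ?thesis by (simp add: spin_beta_def)
qed

text \<open>For \<open>z\<close> in the cone, dividing \<open>w\<^sup>2 - 2 (fst w) w + \<Delta>(w) e = 0\<close> by \<open>2 (fst w)\<close>, where
  \<open>w\<^sup>2 = z\<close>, solves for \<open>w\<close>; here \<open>\<Delta>(w) = \<surd>\<Delta>(z)\<close>, and comparing first components gives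
  \<open>2 (fst w)\<^sup>2 = fst z + \<Delta>(w)\<close>.\<close>

lemma jordan_sqrt_eq:
  fixes z :: "'m::finite spin"
  assumes "z \<in> lorentz_cone"
  shows "jordan_sqrt z = (z + sqrt (spin_Delta z) *\<^sub>R (1, 0))
           /\<^sub>R sqrt (2 * (fst z + sqrt (spin_Delta z)))"
    (is "_ = ?w")
proof -
  obtain l u where z: "z = (l, u)" by (cases z)
  define d where "d = sqrt (spin_Delta z)"
  define r where "r = sqrt (2 * (l + d))"
  have l: "0 < l" and D: "0 < spin_Delta z"
    using assms by (simp_all add: lorentz_cone_iff z)
  then have d: "0 < d" by (simp add: d_def)
  have "d\<^sup>2 = spin_Delta z" using D by (simp add: d_def)
  then have uu: "inner u u = l\<^sup>2 - d\<^sup>2"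
    by (simp add: spin_Delta_def z power2_norm_eq_inner)
  have r: "0 < r" and r2: "r * r = 2 * (l + d)"
    using l d by (simp_all add: r_def)
  have w: "?w = ((l + d) / r, u /\<^sub>R r)"
    by (simp add: z d_def[symmetric] r_def[unfolded d_def] d_def divide_inverse mult.commute)
  have "spin_Delta ((l + d) / r, u /\<^sub>R r) = ((l + d)\<^sup>2 - inner u u) / (r * r)"
    using r by (simp add: spin_Delta_eq field_simps power2_eq_square)
  also have "\<dots> = d" using l d by (simp add: r2 uu field_simps power2_eq_square)
  finally have cone: "?w \<in> lorentz_cone"
    unfolding w using l d r by (simp add: lorentz_cone_iff)
  have "((l + d) / r) * ((l + d) / r) + inner (u /\<^sub>R r) (u /\<^sub>R r)
      = ((l + d)\<^sup>2 + inner u u) / (r * r)"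
    using r by (simp add: field_simps power2_eq_square)
  also have "\<dots> = l" using l d by (simp add: r2 uu field_simps power2_eq_square)
  finally have 1: "((l + d) / r) * ((l + d) / r) + inner (u /\<^sub>R r) (u /\<^sub>R r) = l" .
  have "((l + d) / r) *\<^sub>R (u /\<^sub>R r) + ((l + d) / r) *\<^sub>R (u /\<^sub>R r)
      = (2 * (l + d) / (r * r)) *\<^sub>R u"
    by (simp add: divide_inverse flip: scaleR_add_left)
  also have "\<dots> = u" using l d by (simp add: r2)
  finally have 2: "((l + d) / r) *\<^sub>R (u /\<^sub>R r) + ((l + d) / r) *\<^sub>R (u /\<^sub>R r) = u" .
  have square: "?w \<circ>\<^sub>J ?w = z"
    unfolding w jordan_prod_def fst_conv snd_conv 1 2 by (simp add: z)
  show ?thesis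
    unfolding jordan_sqrt_def
    by (rule the1_equality[OF jordan_sqrt_ex1[OF assms]]) (use cone square in blast)
qed

lemma jordan_square:
  "a \<circ>\<^sub>J a = (fst a * fst a + inner (snd a) (snd a), (2 * fst a) *\<^sub>R snd a)"
proof -
  have "(2 * fst a) *\<^sub>R snd a = fst a *\<^sub>R snd a + fst a *\<^sub>R snd a"
    by (metis mult_2 scaleR_add_left)
  then show ?thesis
    by (simp only: jordan_prod_def)
qed

lemma jordan_sqrt_in_cone_and_square:
  fixes x :: "'m::finite spin"
  assumes "x \<in> lorentz_cone"
  shows "jordan_sqrt x \<in> lorentz_cone" and "jordan_sqrt x \<circ>\<^sub>J jordan_sqrt x = x"
  using theI'[OF jordan_sqrt_ex1[OF assms], folded jordan_sqrt_def] by blast+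

text \<open>With \<open>y' = (fst y, - snd y)\<close> the right-hand side is \<open>2 \<beta>(a, y') a - \<Delta>(a) y'\<close>. If
  \<open>\<Delta>(a) \<noteq> 0\<close>, it is therefore \<open>-\<Delta>(a)\<close> times the image of \<open>y'\<close> under the reflection that is
  orthogonal for \<open>\<beta>\<close> and negates \<open>a\<close>. In this form the properties of \<open>P(a)\<close> are short
  computations.\<close>

lemma jordan_P_eq:
  "jordan_P a y = (2 * inner a y) *\<^sub>R a - spin_Delta a *\<^sub>R (fst y, - snd y)"
proof -
  obtain s w m v where a: "a = (s, w)" and y: "y = (m, v)" by (cases a, cases y)
  show ?thesis
    unfolding jordan_P_def jordan_L_def jordan_square
    by (simp add: a y jordan_prod_def spin_Delta_eq vec_eq_iff
        inner_add_right inner_commute[of v w] algebra_simps)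
qed

lemma jordan_P_add: "jordan_P a (y + z) = jordan_P a y + jordan_P a z"
  by (simp add: jordan_P_eq prod_eq_iff inner_add_right algebra_simps)

lemma jordan_P_scaleR: "jordan_P a (c *\<^sub>R y) = c *\<^sub>R jordan_P a y"
  by (simp add: jordan_P_eq prod_eq_iff algebra_simps)

lemma jordan_P_unit: "jordan_P a (1, 0) = a \<circ>\<^sub>J a"
  unfolding jordan_P_def jordan_L_def jordan_square
  by (simp add: jordan_prod_def vec_eq_iff algebra_simps)

text \<open>Reflections and the conjugation preserve \<open>\<Delta>\<close>, so only the square of the factor
  \<open>-\<Delta>(a)\<close> remains. The computation is the expansion of the quadratic form \<open>\<Delta>\<close>, which also
  covers \<open>\<Delta>(a) = 0\<close>.\<close>

lemma spin_Delta_jordan_P: "spin_Delta (jordan_P a y) = (spin_Delta a)\<^sup>2 * spin_Delta y"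
proof -
  have expand: "spin_Delta (c *\<^sub>R a - d *\<^sub>R (fst y, - snd y))
      = c * c * spin_Delta a - 2 * c * d * inner a y + d * d * spin_Delta y" for c d
    by (simp add: spin_Delta_eq inner_prod_def inner_add_left inner_add_right
        inner_commute[of "snd y" "snd a"] algebra_simps)
  show ?thesis
    unfolding jordan_P_eq expand by (simp add: power2_eq_square algebra_simps)
qed

lemma spin_Delta_square: "spin_Delta (a \<circ>\<^sub>J a) = (spin_Delta a)\<^sup>2"
  using spin_Delta_jordan_P[of a "(1, 0)"] by (simp add: jordan_P_unit spin_Delta_def)

lemma spin_Delta_jordan_inv:
  assumes "spin_Delta a \<noteq> 0"
  shows "spin_Delta (jordan_inv a) = 1 / spin_Delta a"
proof -
  have "spin_Delta (jordan_inv a)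
      = (1 / spin_Delta a) * (1 / spin_Delta a) * (fst a * fst a - inner (snd a) (snd a))"
    by (simp add: jordan_inv_def spin_Delta_eq[of "(_, _)"] diff_divide_distrib)
  with assms show ?thesis by (simp flip: spin_Delta_eq)
qed

lemma jordan_P_inv_eq:
  assumes "spin_Delta a \<noteq> 0"
  shows "jordan_P (jordan_inv a) y
    = (2 * spin_beta a y / (spin_Delta a)\<^sup>2) *\<^sub>R (fst a, - snd a)
      - (1 / spin_Delta a) *\<^sub>R (fst y, - snd y)"
proof -
  have "inner (jordan_inv a) y = spin_beta a y / spin_Delta a"
    by (simp add: jordan_inv_def spin_beta_def inner_prod_def diff_divide_distrib)
  then show ?thesis
    by (simp add: jordan_P_eq spin_Delta_jordan_inv[OF assms])
      (simp add: jordan_inv_def power2_eq_square)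
qed

lemma jordan_P_inverse:
  assumes "spin_Delta a \<noteq> 0"
  shows "jordan_P a (jordan_P (jordan_inv a) y) = y"
proof -
  let ?D = "spin_Delta a" and ?b = "spin_beta a y"
  let ?z = "jordan_P (jordan_inv a) y"
  have "inner a ?z = (2 * ?b / ?D\<^sup>2) * ?D - (1 / ?D) * ?b"
    by (simp add: jordan_P_inv_eq[OF assms] inner_prod_def spin_Delta_eq[of a] spin_beta_def
        inner_diff_right diff_divide_distrib right_diff_distrib)
  then have 1: "inner a ?z = ?b / ?D"
    using assms by (simp add: field_simps power2_eq_square)
  have 2: "(fst ?z, - snd ?z) = (2 * ?b / ?D\<^sup>2) *\<^sub>R a - (1 / ?D) *\<^sub>R y"
    by (simp add: jordan_P_inv_eq[OF assms] prod_eq_iff)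
  show ?thesis
    unfolding jordan_P_eq[of a] 1 2
    using assms by (simp add: scaleR_diff_right power2_eq_square)
qed

text \<open>The first component is the inner product with the unit, so self-adjointness of
  \<open>P(a\<^sup>-\<^sup>1)\<close> moves the computation to \<open>P(a\<^sup>-\<^sup>1) e = (a\<^sup>2)\<^sup>-\<^sup>1\<close>.\<close>

lemma fst_jordan_P_inv:
  assumes "spin_Delta a \<noteq> 0"
  shows "fst (jordan_P (jordan_inv a) y) = spin_beta (a \<circ>\<^sub>J a) y / spin_Delta (a \<circ>\<^sub>J a)"
proof -
  have "fst (jordan_P (jordan_inv a) y)
      = (2 * spin_beta a y * fst a - spin_Delta a * fst y) / (spin_Delta a)\<^sup>2"
    using assms by (simp add: jordan_P_inv_eq field_simps power2_eq_square)
  also have "2 * spin_beta a y * fst a - spin_Delta a * fst y = spin_beta (a \<circ>\<^sub>J a) y"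
    by (simp add: spin_beta_def jordan_square spin_Delta_eq algebra_simps)
  finally show ?thesis by (simp add: spin_Delta_square)
qed

lemma geometric_mean_eq:
  fixes x y :: "'m::finite spin"
  assumes x: "x \<in> lorentz_cone" and y: "y \<in> lorentz_cone"
  shows "x #\<^sub>J y = (sqrt (spin_Delta y) *\<^sub>R x + sqrt (spin_Delta x) *\<^sub>R y)
           /\<^sub>R sqrt (2 * (spin_beta x y + sqrt (spin_Delta x * spin_Delta y)))"
proof -
  define a where "a = jordan_sqrt x"
  define z where "z = jordan_P (jordan_inv a) y"
  define p q where "p = sqrt (spin_Delta x)" and "q = sqrt (spin_Delta y)"
  have a: "a \<in> lorentz_cone" and aa: "a \<circ>\<^sub>J a = x"
    using jordan_sqrt_in_cone_and_square[OF x] by (simp_all add: a_def)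
  have Da: "spin_Delta a \<noteq> 0" using a by (simp add: lorentz_cone_iff)
  have Dx: "0 < spin_Delta x" and Dy: "0 < spin_Delta y"
    using x y by (simp_all add: lorentz_cone_iff)
  have p: "0 < p" "p * p = spin_Delta x"
    using Dx by (simp_all add: p_def)
  have fz: "fst z = spin_beta x y / spin_Delta x"
    using fst_jordan_P_inv[OF Da] by (simp add: z_def aa)
  have Dz: "spin_Delta z = spin_Delta y / spin_Delta x"
    using spin_Delta_square[of a]
    by (simp add: z_def spin_Delta_jordan_P spin_Delta_jordan_inv[OF Da] aa power_divide)
  have z: "z \<in> lorentz_cone"
    using Dx Dy spin_beta_pos[OF x y] by (simp add: lorentz_cone_iff fz Dz)
  have rDz: "sqrt (spin_Delta z) = q / p"
    by (simp add: Dz p_def q_def real_sqrt_divide)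
  \<comment> \<open>This is where the common factor \<open>1 / \<surd>\<Delta>(x)\<close> of numerator and denominator comes out.\<close>
  have "2 * (fst z + q / p) = 2 * (spin_beta x y + p * q) / (p * p)"
    using p(1) by (simp add: fz field_simps flip: p(2))
  then have root: "sqrt (2 * (fst z + q / p)) = sqrt (2 * (spin_beta x y + p * q)) / p"
    using p(1) by (simp add: real_sqrt_divide)
  have "x #\<^sub>J y = jordan_P a (jordan_sqrt z)"
    by (simp add: geometric_mean_def a_def z_def)
  also have "\<dots> = (y + (q / p) *\<^sub>R x) /\<^sub>R sqrt (2 * (fst z + q / p))"
    unfolding jordan_sqrt_eq[OF z] rDz jordan_P_scaleR jordan_P_add jordan_P_unit aa
    by (simp add: z_def jordan_P_inverse[OF Da])
  also have "\<dots> = (q *\<^sub>R x + p *\<^sub>R y) /\<^sub>R sqrt (2 * (spin_beta x y + p * q))"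
    unfolding root using p(1) by (simp add: scaleR_add_right field_simps)
  finally show ?thesis by (simp add: p_def q_def real_sqrt_mult)
qed

theorem proposition9p3:
  fixes x y :: "'m::finite spin" and lam mu :: real and u v :: "real ^ 'm"
  assumes "x = (lam, u)" and "y = (mu, v)"
    and "x \<in> lorentz_cone" and "y \<in> lorentz_cone"
  shows "x #\<^sub>J y =
      (sqrt (spin_Delta y) *\<^sub>R x + sqrt (spin_Delta x) *\<^sub>R y)
        /\<^sub>R sqrt (2 * (spin_beta x y + sqrt (spin_Delta x * spin_Delta y)))
    \<and> x #\<^sub>J y =
      ((sqrt (spin_Delta y) * lam + sqrt (spin_Delta x) * mu)
         / sqrt (2 * (lam * mu - inner u v + sqrt (spin_Delta x * spin_Delta y))),
       (sqrt (spin_Delta y) *\<^sub>R u + sqrt (spin_Delta x) *\<^sub>R v)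
         /\<^sub>R sqrt (2 * (lam * mu - inner u v + sqrt (spin_Delta x * spin_Delta y))))"
  unfolding geometric_mean_eq[OF assms(3,4)]
  by (simp add: prod_eq_iff assms(1,2) spin_beta_def divide_inverse_commute)

end
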